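(* Let $q\geq 3$ be a prime power, $t\geq 2$ an integer, $n=2t$, $w$ a primitive element of $\mathbb{F}_{q^t}$, and $s$ a positive integer with $\gcd(s,t)=1$. Assume $w$ is not of the form $y^{q^s-1}$ with $y\in\mathbb{F}_{q^t}$, and let $b\in\mathbb{F}_{q^t}$ be such that $p(x)=x^2+bx+w$ is irreducible over $\mathbb{F}_{q^t}$. Let $\gamma_0\in\mathbb{F}_{q^n}$ be a root of $p(x)$, let $\tau=\lfloor(q-1)/2\rfloor$, and for $i\in\{0,\ldots,\tau-1\}$ let $\gamma_i=w^i\gamma_0$ and $V_i=\{u+u^{q^s}\gamma_i: u\in\mathbb{F}_{q^t}\}$. Then $G_{n,s}=\bigcup_{i=0}^{\tau-1}C_{V_i}\subseteq\mathcal{G}_q(n,t)$ is a subspace code of size $\tau\cdot\frac{q^n-1}{q-1}$ and minimum distance $2t-2$.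
   Context: $\mathcal{G}_q(n,t)$ is the set of $t$-dimensional $\mathbb{F}_q$-subspaces of $\mathbb{F}_{q^n}$, with subspace distance $d(U,V)=\dim_{\mathbb{F}_q}U+\dim_{\mathbb{F}_q}V-2\dim_{\mathbb{F}_q}(U\cap V)$. A subspace code is a subset of $\mathcal{G}_q(n,t)$; its size is its cardinality and its minimum distance is the minimum of $d$ over pairs of distinct elements. For $V\in\mathcal{G}_q(n,t)$, $C_V=\{\alpha V:\alpha\in\mathbb{F}_{q^n}^*\}$. *)

theory Defs
  imports "HOL-Algebra.Algebra" "HOL-Number_Theory.Prime_Powers"
begin

text \<open>
  \<open>L\<close> is the field of order \<open>q ^ n\<close>; its subfields \<open>F\<close> (the scalars, of order \<open>q\<close>) and
  \<open>K\<close> (of order \<open>q ^ t\<close>) are represented by their carrier sets.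
\<close>

(* Library naming: "subalgebra F V L" only asks that V be an additive subgroup of L closed
   under scalars from F, i.e. an F-subspace of L. *)
definition grassmannian :: "('a, 'b) ring_scheme \<Rightarrow> 'a set \<Rightarrow> nat \<Rightarrow> 'a set set" where
  "grassmannian L F t = {V. subalgebra F V L \<and> ring.dimension L t F V}"

(* Integer-valued, so that the subtraction is not truncated. *)
definition subspace_dist :: "('a, 'b) ring_scheme \<Rightarrow> 'a set \<Rightarrow> 'a set \<Rightarrow> 'a set \<Rightarrow> int" where
  "subspace_dist L F U V =
     int (ring.dim L F U) + int (ring.dim L F V) - 2 * int (ring.dim L F (U \<inter> V))"

(* Meaningful for a finite code with at least two codewords; unspecified otherwise. *)
definition min_distance :: "('a, 'b) ring_scheme \<Rightarrow> 'a set \<Rightarrow> 'a set set \<Rightarrow> int" where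
  "min_distance L F C = Min {subspace_dist L F U V | U V. U \<in> C \<and> V \<in> C \<and> U \<noteq> V}"

definition cyclic_orbit :: "('a, 'b) ring_scheme \<Rightarrow> 'a set \<Rightarrow> 'a set set" where
  "cyclic_orbit L V = {\<alpha> <#\<^bsub>L\<^esub> V | \<alpha>. \<alpha> \<in> carrier L - {\<zero>\<^bsub>L\<^esub>}}"

(* Primitive as in finite-field theory (generator of the multiplicative group of K), not as in
   the primitive element theorem. *)
definition primitive_element :: "('a, 'b) ring_scheme \<Rightarrow> 'a set \<Rightarrow> 'a \<Rightarrow> bool" where
  "primitive_element L K w \<longleftrightarrow>
     w \<in> K - {\<zero>\<^bsub>L\<^esub>} \<and> generate (mult_of (L\<lparr>carrier := K\<rparr>)) {w} = K - {\<zero>\<^bsub>L\<^esub>}"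

definition frob_graph_space :: "('a, 'b) ring_scheme \<Rightarrow> 'a set \<Rightarrow> nat \<Rightarrow> nat \<Rightarrow> 'a \<Rightarrow> 'a set" where
  "frob_graph_space L K q s g =
     {u \<oplus>\<^bsub>L\<^esub> (u [^]\<^bsub>L\<^esub> (q ^ s)) \<otimes>\<^bsub>L\<^esub> g | u. u \<in> K}"

(* The codewords of the i-th orbit are the multiples of V_i, with gamma_i = w^i * gamma_0. *)
definition orbit_union_code ::
  "('a, 'b) ring_scheme \<Rightarrow> 'a set \<Rightarrow> nat \<Rightarrow> nat \<Rightarrow> 'a \<Rightarrow> 'a \<Rightarrow> nat \<Rightarrow> 'a set set" where
  "orbit_union_code L K q s w \<gamma>0 \<tau> =
     (\<Union>i\<in>{0..<\<tau>}. cyclic_orbit L (frob_graph_space L K q s ((w [^]\<^bsub>L\<^esub> i) \<otimes>\<^bsub>L\<^esub> \<gamma>0)))"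

end

theory Submission
  imports Defs
begin

text \<open>
  If \<open>\<alpha> V\<^sub>i\<close> and \<open>\<beta> V\<^sub>j\<close> share two vectors that are linearly independent over \<open>F\<close>, then eliminating
  \<open>\<alpha>\<close> and \<open>\<beta>\<close> gives an identity between products of elements of \<open>V\<^sub>i\<close> and \<open>V\<^sub>j\<close>. Compare coordinates
  in the \<open>K\<close>-basis \<open>1, \<gamma>\<^sub>0\<close>, where \<open>\<gamma>\<^sub>0\<^sup>2 = - b \<gamma>\<^sub>0 - w\<close>. Since \<open>w\<^bsup>i+j+1\<^esup>\<close> is not a \<open>(q - 1)\<close>-th power
  (as \<open>0 < i + j + 1 < q - 1\<close>), the coordinates at \<open>1\<close> force a multiplicative relation, and with it the
  coordinates at \<open>\<gamma>\<^sub>0\<close> give \<open>i = j\<close> and \<open>\<alpha> / \<beta> \<in> F\<close>. So distinct codewords meet in dimension at most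
  \<open>1\<close>, and each orbit has \<open>(q\<^sup>n - 1) / (q - 1)\<close> elements. Dimensions over \<open>F\<close> are read off from
  cardinalities.
\<close>

section \<open>Finite subfields and dimensions\<close>

text \<open>Induction by Pascal's rule: multiplying the expansion by \<open>x\<close> and by
  \<open>y\<close> gives sums with coefficients \<open>n choose k\<close> and
  \<open>n choose Suc k\<close> at the same monomial.\<close>

lemma (in cring) binomial_finsum:
  assumes x: "x \<in> carrier R" and y: "y \<in> carrier R"
  shows "(x \<oplus> y) [^] (n::nat) = (\<Oplus>k\<in>{..n}. add_pow R (n choose k) (x [^] k \<otimes> y [^] (n - k)))"
proof (induction n)
  case 0
  then show ?case by simp
next
  case (Suc n)
  define f where "f = (\<lambda>n k. add_pow R (n choose k) (x [^] k \<otimes> y [^] (n - k)))"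
  have IH: "(x \<oplus> y) [^] n = finsum R (f n) {..n}"
    using Suc by (simp only: f_def)
  have f: "f n k \<in> carrier R" for n k
    using x y by (simp add: f_def)
  have X: "finsum R (f n) {..n} \<otimes> x = (\<Oplus>k\<in>{..n}. add_pow R (n choose k) (x [^] Suc k \<otimes> y [^] (n - k)))"
    using x y by (subst finsum_ldistr)
      (auto simp: f_def m_ac add_pow_rdistr intro!: finsum_cong')
  have "finsum R (f n) {..n} \<otimes> y = (\<Oplus>k\<in>{..n}. add_pow R (n choose k) (x [^] k \<otimes> y [^] (Suc n - k)))"
    using x y by (subst finsum_ldistr)
      (auto simp: f_def m_ac add_pow_rdistr Suc_diff_le intro!: finsum_cong')
  \<comment> \<open>The added index \<open>Suc n\<close> has coefficient
    \<open>n choose Suc n = 0\<close>; splitting off index \<open>0\<close> next shifts the sum to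
    the range of \<open>X\<close>.\<close>
  also have "\<dots> = (\<Oplus>k\<in>{..Suc n}. add_pow R (n choose k) (x [^] k \<otimes> y [^] (Suc n - k)))"
    using x y by (subst finsum_Suc) (auto simp: binomial_eq_0)
  also have "\<dots> = (\<Oplus>k\<in>{..n}. add_pow R (n choose Suc k) (x [^] Suc k \<otimes> y [^] (n - k))) \<oplus> y [^] Suc n"
    using x y by (subst finsum_Suc2) auto
  finally have Y: "finsum R (f n) {..n} \<otimes> y = \<dots>" .
  have "(x \<oplus> y) [^] Suc n = finsum R (f n) {..n} \<otimes> x \<oplus> finsum R (f n) {..n} \<otimes> y"
    using x y f IH by (simp add: r_distr)
  also have "\<dots> = (\<Oplus>k\<in>{..n}. add_pow R (n choose k) (x [^] Suc k \<otimes> y [^] (n - k)))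
      \<oplus> (\<Oplus>k\<in>{..n}. add_pow R (n choose Suc k) (x [^] Suc k \<otimes> y [^] (n - k))) \<oplus> y [^] Suc n"
    unfolding X Y using x y by (subst a_assoc) auto
  also have "\<dots> = (\<Oplus>k\<in>{..n}. f (Suc n) (Suc k)) \<oplus> f (Suc n) 0"
    using x y by (subst finsum_addf [symmetric])
      (auto simp: f_def add.nat_pow_mult intro!: finsum_cong')
  also have "\<dots> = finsum R (f (Suc n)) {..Suc n}"
    using f by (subst finsum_Suc2) auto
  finally show ?case by (simp only: f_def)
qed

lemma (in cring) add_pow_char_zero:
  assumes "add_pow R (p::nat) \<one> = \<zero>" "p dvd m" "z \<in> carrier R"
  shows "add_pow R m z = \<zero>"
proof -
  obtain c where "m = p * c" using assms(2) by blast
  then have "add_pow R m z = add_pow R c (add_pow R p (\<one> \<otimes> z))"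
    using assms(3) by (simp add: add.nat_pow_pow mult.commute)
  also have "\<dots> = \<zero>"
    using assms by (subst add_pow_ldistr [symmetric]) auto
  finally show ?thesis .
qed

text \<open>A prime \<open>p\<close> divides \<open>p choose k\<close> for \<open>0 < k < p\<close>,
  so only the two extreme terms of the binomial expansion survive.\<close>

lemma (in cring) frobenius_add:
  assumes p: "Factorial_Ring.prime p" "add_pow R (p::nat) \<one> = \<zero>"
    and x: "x \<in> carrier R" and y: "y \<in> carrier R"
  shows "(x \<oplus> y) [^] p = x [^] p \<oplus> y [^] p"
proof -
  have 0: "add_pow R (p choose k) (x [^] k \<otimes> y [^] (p - k)) = \<zero>" if "k \<in> {..p} - {0, p}" for k
    using that x y by (intro add_pow_char_zero [OF p(2)] dvd_choose_prime p) auto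
  have p0: "p \<noteq> 0" using p by auto
  have "(x \<oplus> y) [^] p = (\<Oplus>k\<in>{0, p}. add_pow R (p choose k) (x [^] k \<otimes> y [^] (p - k)))"
    unfolding binomial_finsum [OF x y]
    by (rule add.finprod_mono_neutral_cong) (use 0 x y in auto)
  also have "\<dots> = x [^] p \<oplus> y [^] p"
    using x y p0 by (simp add: finsum_insert a_comm)
  finally show ?thesis .
qed

lemma (in cring) frobenius_power_add:
  assumes p: "Factorial_Ring.prime p" "add_pow R (p::nat) \<one> = \<zero>"
    and x: "x \<in> carrier R" and y: "y \<in> carrier R"
  shows "(x \<oplus> y) [^] (p ^ m) = x [^] (p ^ m) \<oplus> y [^] (p ^ m)"
  by (induction m) (use x y frobenius_add [OF p] in \<open>simp_all add: mult.commute[of p] flip: nat_pow_pow\<close>)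

lemma (in domain) nat_pow_nonzero:
  assumes "x \<in> carrier R" "x \<noteq> \<zero>"
  shows "x [^] (n::nat) \<noteq> \<zero>"
  using assms by (induction n) (auto simp: integral_iff)

text \<open>By Lagrange in the additive group, \<open>p ^ m\<close> times \<open>\<one>\<close> is
  zero. This multiple is the \<open>m\<close>-th power of \<open>p\<close> times
  \<open>\<one>\<close>, and a domain has no nonzero nilpotents.\<close>

lemma (in domain) char_of_finite:
  assumes "card (carrier R) = p ^ m"
  shows "add_pow R (p::nat) \<one> = \<zero>"
proof -
  have "add_pow R (p ^ m) \<one> = \<zero>"
    using add.pow_order_eq_1 [of \<one>] assms by (simp add: order_def)
  moreover have "add_pow R (p ^ k) \<one> = (add_pow R p \<one>) [^] k" for k :: nat
  proof (induction k)
    case (Suc k)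
    have "add_pow R (p ^ Suc k) \<one> = add_pow R p (add_pow R (p ^ k) \<one>)"
      by (simp add: add.nat_pow_pow mult.commute)
    also have "\<dots> = (add_pow R p \<one>) \<otimes> (add_pow R (p ^ k) \<one>)"
      by (subst add_pow_ldistr) auto
    finally show ?case using Suc by (simp add: m_comm)
  qed simp
  ultimately show ?thesis
    using nat_pow_nonzero [of "add_pow R p \<one>" m] by auto
qed

section \<open>Finite subfields as root sets, and dimension through cardinality\<close>

context field
begin

lemma subfield_pow_card_minus_one:
  assumes K: "subfield K R" "finite K" and x: "x \<in> K - {\<zero>}"
  shows "x [^] (card K - 1) = \<one>"
proof -
  interpret K: field "R\<lparr>carrier := K\<rparr>"
    using subfield_iff(2) [OF K(1)] .
  have "\<zero> \<in> K"
    using subringE(2) [OF subfieldE(1) [OF K(1)]] .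
  then have "order (Multiplicative_Group.mult_of (R\<lparr>carrier := K\<rparr>)) = card K - 1"
    using K(2) by (simp add: order_def Multiplicative_Group.carrier_mult_of)
  then show ?thesis
    using group.pow_order_eq_1 [OF K.field_mult_group, of x] x
    by (simp add: Multiplicative_Group.mult_of_simps nat_pow_consistent [symmetric])
qed

text \<open>The nonzero elements of \<open>K\<close> are \<open>card K - 1\<close> roots of
  \<open>X^(card K - 1) - 1\<close>, which has no further roots in a field. Membership in
  \<open>K\<close> thus becomes a power equation.\<close>

lemma subfield_fixed_points:
  assumes K: "subfield K R" and fin: "finite (carrier R)"
  shows "K = {x \<in> carrier R. x [^] card K = x}"
proof -
  note sub = subringE [OF subfieldE(1) [OF K]]
  have finK: "finite K" using sub(1) fin finite_subset by blast
  have "{\<zero>, \<one>} \<subseteq> K" using sub by auto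
  then have card2: "card K \<ge> 2"
    using card_mono [OF finK, of "{\<zero>, \<one>}"] subfieldE(6) [OF K] by auto
  then obtain d where d: "card K = Suc d" "d \<noteq> 0"
    by (cases "card K") auto
  have "K - {\<zero>} \<subseteq> {x \<in> carrier R. x [^] d = \<one>}"
    using subfield_pow_card_minus_one [OF K finK] sub(1) d by auto
  moreover have "card {x \<in> carrier R. x [^] d = \<one>} \<le> card (K - {\<zero>})"
    using num_roots_le_deg [OF fin d(2)] sub(2) finK d by simp
  ultimately have eq: "K - {\<zero>} = {x \<in> carrier R. x [^] d = \<one>}"
    using fin by (intro card_seteq) auto
  have "x \<in> K \<longleftrightarrow> x [^] card K = x" if x: "x \<in> carrier R" for x
  proof (cases "x = \<zero>")
    case True
    then show ?thesis using sub(2) d by (simp add: nat_pow_zero)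
  next
    case False
    have "x [^] card K = x \<longleftrightarrow> x [^] d \<otimes> x = \<one> \<otimes> x"
      using x d by simp
    also have "\<dots> \<longleftrightarrow> x [^] d = \<one>"
      using x False by (intro m_rcancel) auto
    also have "\<dots> \<longleftrightarrow> x \<in> K"
      using eq x False by blast
    finally show ?thesis by blast
  qed
  then show ?thesis using sub(1) by blast
qed

text \<open>A line extension by a vector outside \<open>E\<close> is in bijection with
  \<open>K \<times> E\<close>, so every dimension step multiplies the cardinality by
  \<open>card K\<close>.\<close>

lemma card_dimension:
  assumes "subfield K R" and "dimension n K E"
  shows "card E = card K ^ n"
  using assms(2,1)
proof (induction n K E rule: dimension.induct)
  case zero_dim
  then show ?case by simp
next
  case (Suc_dim v E n K)
  note K = Suc_dim.prems
  note sub = subringE [OF subfieldE(1) [OF K]]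
  note E = space_subgroup_props [OF K Suc_dim.hyps(3)]
  have eq: "line_extension K v E = (\<lambda>(k, e). k \<otimes> v \<oplus> e) ` (K \<times> E)"
    by (fastforce simp: line_extension_mem_iff image_iff)
  have "inj_on (\<lambda>(k, e). k \<otimes> v \<oplus> e) (K \<times> E)"
  proof (rule inj_onI, clarsimp)
    fix k e k' e'
    assume *: "k \<in> K" "e \<in> E" "k' \<in> K" "e' \<in> E" "k \<otimes> v \<oplus> e = k' \<otimes> v \<oplus> e'"
    then have car: "k \<in> carrier R" "k' \<in> carrier R" "e \<in> carrier R" "e' \<in> carrier R"
      using sub(1) E(1) by auto
    \<comment> \<open>Two representations of one vector put
      \<open>(k \<ominus> k') \<otimes> v\<close> into \<open>E\<close>; as \<open>v\<close> lies
      outside \<open>E\<close>, the scalar must vanish.\<close>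
    have "(k \<ominus> k') \<otimes> v = (k \<otimes> v \<oplus> e) \<ominus> (k' \<otimes> v \<oplus> e') \<oplus> (e' \<ominus> e)"
      using car Suc_dim.hyps(1) by algebra
    also have "\<dots> = e' \<ominus> e"
      using car Suc_dim.hyps(1) unfolding *(5) by algebra
    finally have "(k \<ominus> k') \<otimes> v \<in> E"
      using E * by (simp add: minus_eq)
    then have "k \<ominus> k' = \<zero>"
      using E(6) [of "k \<ominus> k'" v] sub(5,7) * Suc_dim.hyps(1,2) by (auto simp: minus_eq)
    then show "k = k' \<and> e = e'"
      using car * Suc_dim.hyps(1) by auto
  qed
  then have "card (line_extension K v E) = card K * card E"
    unfolding eq by (simp add: card_image card_cartesian_product)
  then show ?case using Suc_dim.IH K by simp
qed

text \<open>A list of all elements of the finite field spans it, and subspaces inherit finite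
  dimension.\<close>

lemma finite_dimension_subalgebra:
  assumes K: "subfield K R" and fin: "finite (carrier R)" and V: "subalgebra K V R"
  shows "finite_dimension K V"
proof -
  obtain xs where xs: "set xs = carrier R"
    using fin finite_list by blast
  have "set xs \<subseteq> Span K xs"
    using Span_base_incl [OF K] xs by blast
  with xs have "Span K xs = carrier R"
    using Span_in_carrier [of K xs] subfieldE(3) [OF K] by blast
  then have "finite_dimension K (carrier R)"
    using Span_finite_dimension [OF K, of xs] xs by simp
  then show ?thesis
    using subalbegra_incl_imp_finite_dimension [OF K _ V] subalgebra_in_carrier [OF V] by blast
qed

text \<open>Some dimension \<open>m\<close> exists, and \<open>card K ^ m = card K ^ n\<close> with
  \<open>card K \<ge> 2\<close> forces \<open>m = n\<close>. No basis of a codeword has to be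
  exhibited.\<close>

lemma dimension_of_card:
  assumes K: "subfield K R" and fin: "finite (carrier R)"
    and V: "subalgebra K V R" "card V = card K ^ n"
  shows "dimension n K V"
proof -
  note sub = subringE [OF subfieldE(1) [OF K]]
  have finK: "finite K" using sub(1) fin finite_subset by blast
  obtain m where m: "dimension m K V"
    using finite_dimension_subalgebra [OF K fin V(1)] by blast
  have "{\<zero>, \<one>} \<subseteq> K" using sub by auto
  then have "card K \<ge> 2"
    using card_mono [OF finK, of "{\<zero>, \<one>}"] subfieldE(6) [OF K] by auto
  moreover have "card K ^ m = card K ^ n"
    using card_dimension [OF K m] V(2) by simp
  ultimately have "m = n" by (simp add: power_inject_exp)
  with m show ?thesis by simp
qed

end

section \<open>Frobenius graph spaces\<close>

(* HOL-Algebra has two identical constants mult_of; Defs uses the one from Ring_Divisibility,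
   the facts about finite fields are stated for the other. *)
lemma mult_of_eq: "Ring_Divisibility.mult_of R = Multiplicative_Group.mult_of R"
  by (simp add: Ring_Divisibility.mult_of_def Multiplicative_Group.mult_of_def)

locale frobenius_graph_code = field L for L (structure) +
  fixes F K :: "'a set" and q t s \<tau> :: nat and w b \<gamma> :: 'a
  assumes q: "primepow q" "q \<ge> 3" and t: "t \<ge> 2"
    and fin: "finite (carrier L)" and card_L: "card (carrier L) = q ^ (2 * t)"
    and F: "subfield F L" "card F = q"
    and K: "subfield K L" "card K = q ^ t"
    and w: "primitive_element L K w"
    and s: "s > 0" "gcd s t = 1"
    and b: "b \<in> K" and irred: "pirreducible K [\<one>, b, w]"
    and root: "\<gamma> \<in> carrier L" "eval [\<one>, b, w] \<gamma> = \<zero>"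
    and \<tau>: "\<tau> = (q - 1) div 2"
begin

section \<open>The twisted Frobenius map and its fixed field\<close>

text \<open>On \<open>K\<close> this is a generator of the Galois group over \<open>F\<close>, since
  \<open>s\<close> is coprime to \<open>t\<close>.\<close>

definition frob :: "'a \<Rightarrow> 'a"
  where "frob x = x [^] (q ^ s)"

lemmas K_sub = subringE [OF subfieldE(1) [OF K(1)]]
lemmas F_sub = subringE [OF subfieldE(1) [OF F(1)]]

lemma K_carrier: "x \<in> K \<Longrightarrow> x \<in> carrier L"
  using K_sub(1) by blast

lemma F_carrier: "x \<in> F \<Longrightarrow> x \<in> carrier L"
  using F_sub(1) by blast

lemma K_minus: "x \<in> K \<Longrightarrow> y \<in> K \<Longrightarrow> x \<ominus> y \<in> K"
  using K_sub(5,7) by (simp add: minus_eq)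

lemma K_pow: "x \<in> K \<Longrightarrow> x [^] (n::nat) \<in> K"
  by (induction n) (use K_sub in auto)

lemma w_K: "w \<in> K" and w_nz: "w \<noteq> \<zero>"
  using w by (auto simp: primitive_element_def)

lemma frob_closed [simp]: "x \<in> carrier L \<Longrightarrow> frob x \<in> carrier L"
  by (simp add: frob_def)

lemma frob_K: "x \<in> K \<Longrightarrow> frob x \<in> K"
  by (simp add: frob_def K_pow)

lemma frob_mult: "x \<in> carrier L \<Longrightarrow> y \<in> carrier L \<Longrightarrow> frob (x \<otimes> y) = frob x \<otimes> frob y"
  by (simp add: frob_def nat_pow_distrib)

text \<open>\<open>q ^ s\<close> is a power of the prime \<open>p\<close> below \<open>q\<close>,
  and \<open>p\<close> is the characteristic because \<open>card (carrier L)\<close> is a power of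
  \<open>p\<close>.\<close>

lemma frob_add:
  assumes "x \<in> carrier L" "y \<in> carrier L"
  shows "frob (x \<oplus> y) = frob x \<oplus> frob y"
proof -
  obtain p k where p: "Factorial_Ring.prime p" "q = p ^ k"
    using q(1) by (auto simp: primepow_def)
  have "add_pow L p \<one> = \<zero>"
    using char_of_finite [of p "k * (2 * t)"] card_L p(2) by (simp add: power_mult)
  then show ?thesis
    using frobenius_power_add [OF p(1) _ assms, of "k * s"]
    unfolding frob_def unfolding p(2) power_mult by blast
qed

lemma frob_nonzero: "x \<in> carrier L \<Longrightarrow> x \<noteq> \<zero> \<Longrightarrow> frob x \<noteq> \<zero>"
  by (simp add: frob_def nat_pow_nonzero)

lemma frob_diff:
  assumes "x \<in> carrier L" "y \<in> carrier L"
  shows "frob (x \<ominus> y) = frob x \<ominus> frob y"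
proof -
  have "x = (x \<ominus> y) \<oplus> y"
    using assms by algebra
  then have "frob x = frob (x \<ominus> y) \<oplus> frob y"
    using assms frob_add [of "x \<ominus> y" y] by simp
  moreover have "frob (x \<ominus> y) = (frob (x \<ominus> y) \<oplus> frob y) \<ominus> frob y"
    using frob_closed [of "x \<ominus> y"] frob_closed [of y] assms by (simp add: minus_eq a_assoc r_neg)
  ultimately show ?thesis by simp
qed

lemma pow_iterate: "x \<in> carrier L \<Longrightarrow> x [^] (m::nat) = x \<Longrightarrow> x [^] (m ^ k) = x"
  by (induction k) (auto simp: mult.commute[of m] simp flip: nat_pow_pow)

lemma F_iff: "x \<in> F \<longleftrightarrow> x \<in> carrier L \<and> x [^] q = x"
  using subfield_fixed_points [OF F(1) fin] F(2) by auto

lemma K_iff: "x \<in> K \<longleftrightarrow> x \<in> carrier L \<and> x [^] (q ^ t) = x"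
  using subfield_fixed_points [OF K(1) fin] K(2) by auto

lemma F_subset_K: "x \<in> F \<Longrightarrow> x \<in> K"
  using pow_iterate by (auto simp: F_iff K_iff)

lemma frob_F: "x \<in> F \<Longrightarrow> frob x = x"
  using pow_iterate by (auto simp: F_iff frob_def)

text \<open>Bezout gives \<open>s * k = t * l + 1\<close>. Iterating \<open>frob\<close>
  \<open>k\<close> times fixes \<open>x\<close>, but also acts as \<open>l\<close> rounds of the
  \<open>q ^ t\<close>-th power, trivial on \<open>K\<close>, followed by the \<open>q\<close>-th
  power.\<close>

lemma fixed_in_F:
  assumes "x \<in> K" "frob x = x"
  shows "x \<in> F"
proof -
  have x: "x \<in> carrier L" using assms K_carrier by blast
  obtain k l where kl: "s * k = t * l + 1"
    using bezout_nat [of s t] s by auto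
  have "x = x [^] ((q ^ s) ^ k)"
    using pow_iterate [OF x, of "q ^ s" k] assms by (simp add: frob_def)
  also have "\<dots> = (x [^] ((q ^ t) ^ l)) [^] q"
    using x kl by (simp add: nat_pow_pow power_mult [symmetric] mult.commute[of q])
  also have "x [^] ((q ^ t) ^ l) = x"
    using pow_iterate [OF x, of "q ^ t" l] assms K_iff by simp
  finally show ?thesis using x by (simp add: F_iff)
qed

lemma K_inv:
  assumes "x \<in> K" "x \<noteq> \<zero>"
  obtains y where "y \<in> K" "y \<otimes> x = \<one>" "y \<noteq> \<zero>"
  using subfield_m_inv [OF K(1), of x] assms by auto

lemma K_nonzero_pow: "x \<in> K \<Longrightarrow> x \<noteq> \<zero> \<Longrightarrow> x [^] (q ^ t - 1) = \<one>"
  using subfield_pow_card_minus_one [OF K(1), of x] K(2) fin K_sub(1) finite_subset by auto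

section \<open>Powers of the primitive element\<close>

lemma w_pow_inj:
  assumes "w [^] (m::nat) = w [^] (k::nat)" "m < q ^ t - 1" "k < q ^ t - 1"
  shows "m = k"
proof -
  define M where "M = Multiplicative_Group.mult_of (L\<lparr>carrier := K\<rparr>)"
  interpret K: field "L\<lparr>carrier := K\<rparr>"
    using subfield_iff(2) [OF K(1)] .
  interpret M: group M
    unfolding M_def using K.field_mult_group .
  have wM: "w \<in> carrier M"
    using w_K w_nz by (simp add: M_def Multiplicative_Group.carrier_mult_of)
  have "M.ord w = card (K - {\<zero>})"
    using M.generate_pow_card [OF wM] w by (simp add: M_def primitive_element_def mult_of_eq)
  then have ord: "M.ord w = q ^ t - 1"
    using K_sub(2) K(2) by simp
  have "finite (carrier M)"
    using finite_subset [OF K_sub(1) fin] by (simp add: M_def Multiplicative_Group.carrier_mult_of)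
  then have "inj_on (\<lambda>i::nat. w [^]\<^bsub>M\<^esub> i) {0..M.ord w - 1}"
    using M.ord_inj [OF wM] by simp
  moreover have "w [^]\<^bsub>M\<^esub> m = w [^]\<^bsub>M\<^esub> k"
    using assms(1) by (simp add: M_def Multiplicative_Group.nat_pow_mult_of nat_pow_consistent [symmetric])
  ultimately show ?thesis
    using assms(2,3) ord by (auto dest: inj_onD)
qed

text \<open>The quotient is the geometric sum of the \<open>q ^ i\<close>. For \<open>n = t\<close>
  it is the exponent of the norm from \<open>K\<close> to \<open>F\<close>.\<close>

lemma geometric_dvd: "\<exists>N. q ^ n - 1 = (q - 1) * N" for n :: nat
proof -
  have "int (q ^ n - 1) = int ((q - 1) * (\<Sum>i<n. q ^ i))"
    using q(2) power_diff_1_eq [of "int q" n] by (simp add: of_nat_diff)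
  then show ?thesis unfolding of_nat_eq_iff by blast
qed

text \<open>
  Raising \<open>w ^ m * y = w ^ k * frob y\<close> to the power \<open>(q ^ t - 1) / (q - 1)\<close> removes \<open>y\<close>, because
  \<open>frob y / y\<close> is a \<open>(q - 1)\<close>-th power.
\<close>
lemma w_pow_twisted_inj:
  assumes y: "y \<in> K" "y \<noteq> \<zero>" and eq: "w [^] (m::nat) \<otimes> y = w [^] (k::nat) \<otimes> frob y"
    and mk: "m < q - 1" "k < q - 1"
  shows "m = k"
proof -
  obtain N where N: "q ^ t - 1 = (q - 1) * N" using geometric_dvd by blast
  obtain M where M: "q ^ s - 1 = (q - 1) * M" using geometric_dvd by blast
  have "q ^ t > 1" using q(2) t by (intro one_less_power) auto
  then have N0: "N > 0" using N by (cases N) auto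
  have car: "y \<in> carrier L" "w \<in> carrier L" using y w_K K_carrier by auto
  \<comment> \<open>Both \<open>(q ^ s - 1) * N\<close> and \<open>(q ^ t - 1) * M\<close> equal
    \<open>(q - 1) * M * N\<close>. As \<open>q ^ t - 1\<close> kills \<open>y\<close>, the
    \<open>N\<close>-th powers of \<open>frob y\<close> and \<open>y\<close> agree.\<close>
  have "q ^ s * N = N + (q ^ t - 1) * M"
  proof -
    have "q ^ s = (q - 1) * M + 1" using M q(2)
      by (metis add.commute le_add_diff_inverse nat_le_iff_add one_le_power le_trans one_le_numeral)
    then show ?thesis using N by (simp add: algebra_simps)
  qed
  then have "frob y [^] N = y [^] N \<otimes> (y [^] (q ^ t - 1)) [^] M"
    using car by (simp add: frob_def nat_pow_pow nat_pow_mult)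
  then have frobN: "frob y [^] N = y [^] N"
    using K_nonzero_pow [OF y] car by simp
  have "w [^] (m * N) \<otimes> y [^] N = (w [^] m \<otimes> y) [^] N"
    using car by (simp add: nat_pow_distrib nat_pow_pow)
  also have "\<dots> = w [^] (k * N) \<otimes> y [^] N"
    using car frobN unfolding eq by (simp add: nat_pow_distrib nat_pow_pow)
  finally have "w [^] (m * N) = w [^] (k * N)"
    using car nat_pow_nonzero [OF car(1) y(2), of N] by (simp add: m_rcancel)
  moreover have "m * N < q ^ t - 1" "k * N < q ^ t - 1"
    unfolding N using mk N0 by (metis mult_less_mono1)+
  ultimately show ?thesis
    using w_pow_inj N0 by fastforce
qed

section \<open>Coordinates over K in the basis 1, \<gamma>\<close>

lemma \<gamma>_square: "\<gamma> \<otimes> \<gamma> = \<ominus> (b \<otimes> \<gamma>) \<ominus> w"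
proof -
  have car: "b \<in> carrier L" "w \<in> carrier L" "\<gamma> \<in> carrier L"
    using b w_K K_carrier root by auto
  have "\<gamma> \<otimes> \<gamma> \<oplus> (b \<otimes> \<gamma> \<oplus> w) = \<zero>"
    using root car by (simp add: numeral_2_eq_2)
  then have "\<gamma> \<otimes> \<gamma> = \<ominus> (b \<otimes> \<gamma> \<oplus> w)"
    using car by (simp add: minus_equality)
  then show ?thesis
    using car by (simp add: minus_eq minus_add)
qed

text \<open>If \<gamma> were in \<open>K\<close>, the polynomial would split there with second root
  \<open>\<ominus> (b \<oplus> \<gamma>)\<close>. Units of \<open>K[X]\<close> are constants, so
  both linear factors would contradict irreducibility.\<close>

lemma \<gamma>_notin_K: "\<gamma> \<notin> K"
proof
  assume \<gamma>: "\<gamma> \<in> K"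
  have car: "b \<in> carrier L" "w \<in> carrier L" "\<gamma> \<in> carrier L"
    using b w_K K_carrier root by auto
  have one: "\<one> \<in> K" "\<one> \<noteq> \<zero>" by (auto simp: K_sub)
  have poly: "[\<one>, \<ominus> \<gamma>] \<in> carrier (K[X])" "[\<one>, b \<oplus> \<gamma>] \<in> carrier (K[X])"
    "[\<one>, b, w] \<in> carrier (K[X])"
    using \<gamma> b w_K K_sub by (auto simp: polynomial_def simp flip: univ_poly_carrier)
  have "\<ominus> \<gamma> \<otimes> (b \<oplus> \<gamma>) = \<ominus> (b \<otimes> \<gamma>) \<ominus> \<gamma> \<otimes> \<gamma>"
    using car by algebra
  also have "\<dots> = w"
    unfolding \<gamma>_square using car by algebra
  finally have c0: "\<ominus> \<gamma> \<otimes> (b \<oplus> \<gamma>) = w" .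
  have c1: "b \<oplus> \<gamma> \<oplus> \<ominus> \<gamma> = b"
    using car by algebra
  have "[\<one>, b, w] = [\<one>, \<ominus> \<gamma>] \<otimes>\<^bsub>K[X]\<^esub> [\<one>, b \<oplus> \<gamma>]"
    using car c0 c1 by (simp add: univ_poly_mult)
  then have "[\<one>, \<ominus> \<gamma>] \<in> Units (K[X]) \<or> [\<one>, b \<oplus> \<gamma>] \<in> Units (K[X])"
    using pirreducibleE(3) [OF subfieldE(1) [OF K(1)] poly(3) irred poly(1,2)] by blast
  then show False
    using univ_poly_units_incl [OF subfieldE(1) [OF K(1)]] by auto
qed

text \<open>If \<open>y\<close> and \<open>y'\<close> differed, \<gamma> would be a quotient of
  elements of \<open>K\<close>.\<close>

lemma coordinates:
  assumes "x \<in> K" "y \<in> K" "x' \<in> K" "y' \<in> K" and eq: "x \<oplus> y \<otimes> \<gamma> = x' \<oplus> y' \<otimes> \<gamma>"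
  shows "x = x'" "y = y'"
proof -
  have car: "x \<in> carrier L" "y \<in> carrier L" "x' \<in> carrier L" "y' \<in> carrier L" "\<gamma> \<in> carrier L"
    using assms K_carrier root by auto
  have "(y \<ominus> y') \<otimes> \<gamma> = (x \<oplus> y \<otimes> \<gamma>) \<ominus> (x' \<oplus> y' \<otimes> \<gamma>) \<oplus> (x' \<ominus> x)"
    using car by algebra
  also have "\<dots> = x' \<ominus> x"
    unfolding eq using car by algebra
  finally have "(y \<ominus> y') \<otimes> \<gamma> \<in> K"
    using assms K_minus by simp
  then have "y \<ominus> y' = \<zero>"
    using subfield_m_inv_simprule [OF K(1), of "y \<ominus> y'" \<gamma>] assms K_minus root \<gamma>_notin_K by auto
  then show "y = y'" using car by simp
  then show "x = x'" using car eq by simp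
qed

text \<open>Expand and eliminate the square of \<gamma>. The factor \<open>w\<close> in the constant
  coordinate is the source of the \<open>1\<close> in the exponent \<open>i + j + 1\<close> used
  later.\<close>

lemma product_coordinates:
  assumes "x \<in> K" "y \<in> K" "x' \<in> K" "y' \<in> K"
  shows "(x \<oplus> y \<otimes> \<gamma>) \<otimes> (x' \<oplus> y' \<otimes> \<gamma>) =
    (x \<otimes> x' \<ominus> w \<otimes> (y \<otimes> y')) \<oplus> (x \<otimes> y' \<oplus> x' \<otimes> y \<ominus> b \<otimes> (y \<otimes> y')) \<otimes> \<gamma>"
proof -
  have car: "x \<in> carrier L" "y \<in> carrier L" "x' \<in> carrier L" "y' \<in> carrier L" "\<gamma> \<in> carrier L"
    "b \<in> carrier L" "w \<in> carrier L"
    using assms K_carrier root b w_K by auto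
  have "(x \<oplus> y \<otimes> \<gamma>) \<otimes> (x' \<oplus> y' \<otimes> \<gamma>) =
      x \<otimes> x' \<oplus> (x \<otimes> y' \<oplus> x' \<otimes> y) \<otimes> \<gamma> \<oplus> (y \<otimes> y') \<otimes> (\<gamma> \<otimes> \<gamma>)"
    using car by algebra
  also have "\<dots> = (x \<otimes> x' \<ominus> w \<otimes> (y \<otimes> y')) \<oplus> (x \<otimes> y' \<oplus> x' \<otimes> y \<ominus> b \<otimes> (y \<otimes> y')) \<otimes> \<gamma>"
    unfolding \<gamma>_square using car by algebra
  finally show ?thesis .
qed

section \<open>The spaces V_i and products of their elements\<close>

text \<open>The element of V_i with parameter \<open>u\<close>, arranged by its
  \<open>K\<close>-coordinates so that comparison of coordinates applies directly.\<close>

definition vec :: "nat \<Rightarrow> 'a \<Rightarrow> 'a"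
  where "vec i u = u \<oplus> (w [^] i \<otimes> frob u) \<otimes> \<gamma>"

abbreviation space :: "nat \<Rightarrow> 'a set"
  where "space i \<equiv> vec i ` K"

lemma frob_graph_space_eq: "frob_graph_space L K q s (w [^] i \<otimes> \<gamma>) = space i"
proof -
  have "u \<oplus> u [^] (q ^ s) \<otimes> (w [^] i \<otimes> \<gamma>) = vec i u" if "u \<in> K" for u
    using K_carrier [OF that] K_carrier [OF w_K] root(1) by (simp add: vec_def frob_def m_ac)
  then show ?thesis
    unfolding frob_graph_space_def Setcompr_eq_image by (rule image_cong [OF refl])
qed

lemma twist_K: "u \<in> K \<Longrightarrow> w [^] (i::nat) \<otimes> frob u \<in> K"
  using K_sub(6) K_pow [OF w_K] frob_K by blast

lemma vec_closed: "u \<in> K \<Longrightarrow> vec i u \<in> carrier L"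
  using K_carrier [OF twist_K] K_carrier root(1) by (simp add: vec_def)

lemma vec_inj: "inj_on (vec i) K"
  unfolding vec_def by (intro inj_onI) (metis coordinates(1) twist_K)

lemma vec_add:
  assumes "u \<in> K" "v \<in> K"
  shows "vec i (u \<oplus> v) = vec i u \<oplus> vec i v"
proof -
  have car: "u \<in> carrier L" "v \<in> carrier L" "frob u \<in> carrier L" "frob v \<in> carrier L"
    "w [^] i \<in> carrier L" "\<gamma> \<in> carrier L"
    using assms K_carrier w_K root by auto
  show ?thesis
    unfolding vec_def frob_add [OF car(1,2)] using car by algebra
qed

lemma vec_smult:
  assumes "c \<in> F" "u \<in> K"
  shows "vec i (c \<otimes> u) = c \<otimes> vec i u"
proof -
  have car: "u \<in> carrier L" "c \<in> carrier L" "frob u \<in> carrier L" "w [^] i \<in> carrier L" "\<gamma> \<in> carrier L"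
    using assms K_carrier F_carrier w_K root by auto
  show ?thesis
    unfolding vec_def frob_mult [OF car(2,1)] frob_F [OF assms(1)] using car by algebra
qed

lemma vec_zero: "vec i \<zero> = \<zero>"
  using K_carrier [OF w_K] root(1) q(2) by (simp add: vec_def frob_def nat_pow_zero)

lemma vec_eq_zero_iff: "u \<in> K \<Longrightarrow> vec i u = \<zero> \<longleftrightarrow> u = \<zero>"
  using inj_onD [OF vec_inj, of i u \<zero>] vec_zero K_sub(2) by auto

text \<open>
  The constant coordinates of the hypothesis give \<open>e = w ^ (i + j + 1) * frob e\<close> for
  \<open>e = u1 * v2 - u2 * v1\<close>, whence \<open>e = 0\<close> because \<open>0 < i + j + 1 < q - 1\<close>. With \<open>v = c * u\<close>, the
  coordinates at \<open>\<gamma>\<close> then leave a product of two factors.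
\<close>
lemma cross_product:
  assumes uv: "u1 \<in> K" "v1 \<in> K" "u2 \<in> K" "v2 \<in> K" and nz: "u1 \<noteq> \<zero>" "v1 \<noteq> \<zero>"
    and ij: "i < \<tau>" "j < \<tau>"
    and eq: "vec i u1 \<otimes> vec j v2 = vec i u2 \<otimes> vec j v1"
  shows "(\<exists>d\<in>F. u2 = d \<otimes> u1) \<or> (i = j \<and> (\<exists>c\<in>F. v1 = c \<otimes> u1))"
proof -
  define a where "a = w [^] i"
  define a' where "a' = w [^] j"
  have aK: "a \<in> K" "a' \<in> K" by (simp_all add: a_def a'_def K_pow w_K)
  note K' = K_sub(6,7) K_minus frob_K
  have car: "u1 \<in> carrier L" "v1 \<in> carrier L" "u2 \<in> carrier L" "v2 \<in> carrier L"
    "a \<in> carrier L" "a' \<in> carrier L" "b \<in> carrier L" "w \<in> carrier L"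
    using uv aK b w_K K_carrier by auto
  have fcar: "frob u1 \<in> carrier L" "frob v1 \<in> carrier L" "frob u2 \<in> carrier L" "frob v2 \<in> carrier L"
    using car by auto
  \<comment> \<open>Since \<open>i\<close> and \<open>j\<close> are at most
    \<open>\<tau> - 1\<close> and \<open>2 * \<tau> \<le> q - 1\<close>, the exponent is at most
    \<open>q - 2\<close>. The number of orbits is chosen for this bound.\<close>
  have small: "i + j + 1 < q - 1" "i < q - 1" "j < q - 1"
    using ij \<tau> by auto
  have coords:
    "u1 \<otimes> v2 \<ominus> w \<otimes> (a \<otimes> frob u1 \<otimes> (a' \<otimes> frob v2)) =
     u2 \<otimes> v1 \<ominus> w \<otimes> (a \<otimes> frob u2 \<otimes> (a' \<otimes> frob v1))"
    "u1 \<otimes> (a' \<otimes> frob v2) \<oplus> v2 \<otimes> (a \<otimes> frob u1) \<ominus> b \<otimes> (a \<otimes> frob u1 \<otimes> (a' \<otimes> frob v2)) =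
     u2 \<otimes> (a' \<otimes> frob v1) \<oplus> v1 \<otimes> (a \<otimes> frob u2) \<ominus> b \<otimes> (a \<otimes> frob u2 \<otimes> (a' \<otimes> frob v1))"
  proof -
    have prod: "vec i u \<otimes> vec j v =
        (u \<otimes> v \<ominus> w \<otimes> (a \<otimes> frob u \<otimes> (a' \<otimes> frob v))) \<oplus>
        (u \<otimes> (a' \<otimes> frob v) \<oplus> v \<otimes> (a \<otimes> frob u) \<ominus> b \<otimes> (a \<otimes> frob u \<otimes> (a' \<otimes> frob v))) \<otimes> \<gamma>"
      if "u \<in> K" "v \<in> K" for u v
      unfolding vec_def a_def a'_def
      by (rule product_coordinates) (use that in \<open>simp_all add: twist_K\<close>)
    note eq' = eq [unfolded prod [OF uv(1,4)] prod [OF uv(3,2)]]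
    note mem = K_minus K_sub(6,7) frob_K uv aK b w_K
    show "u1 \<otimes> v2 \<ominus> w \<otimes> (a \<otimes> frob u1 \<otimes> (a' \<otimes> frob v2)) =
     u2 \<otimes> v1 \<ominus> w \<otimes> (a \<otimes> frob u2 \<otimes> (a' \<otimes> frob v1))"
      by (rule coordinates(1) [OF _ _ _ _ eq']) (intro mem)+
    show "u1 \<otimes> (a' \<otimes> frob v2) \<oplus> v2 \<otimes> (a \<otimes> frob u1) \<ominus> b \<otimes> (a \<otimes> frob u1 \<otimes> (a' \<otimes> frob v2)) =
     u2 \<otimes> (a' \<otimes> frob v1) \<oplus> v1 \<otimes> (a \<otimes> frob u2) \<ominus> b \<otimes> (a \<otimes> frob u2 \<otimes> (a' \<otimes> frob v1))"
      by (rule coordinates(2) [OF _ _ _ _ eq']) (intro mem)+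
  qed
  define e where "e = u1 \<otimes> v2 \<ominus> u2 \<otimes> v1"
  have eK: "e \<in> K" using uv by (simp add: e_def K')
  have frob_e: "frob e = frob u1 \<otimes> frob v2 \<ominus> frob u2 \<otimes> frob v1"
    using car by (simp add: e_def frob_diff frob_mult)
  have pw: "w [^] (i + j + 1) = w \<otimes> a \<otimes> a'"
    using car by (simp add: a_def a'_def nat_pow_mult [symmetric] m_ac)
  \<comment> \<open>The first two terms are the two sides of \<open>coords(1)\<close>, so their
    difference vanishes.\<close>
  have "e = (u1 \<otimes> v2 \<ominus> w \<otimes> (a \<otimes> frob u1 \<otimes> (a' \<otimes> frob v2))) \<ominus>
      (u2 \<otimes> v1 \<ominus> w \<otimes> (a \<otimes> frob u2 \<otimes> (a' \<otimes> frob v1))) \<oplus> w \<otimes> a \<otimes> a' \<otimes> frob e"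
    unfolding e_def frob_e [unfolded e_def] using car fcar by algebra
  also have "\<dots> = w [^] (i + j + 1) \<otimes> frob e"
    unfolding coords(1) pw using car fcar frob_closed [OF K_carrier [OF eK]] by algebra
  finally have tw: "w [^] (0::nat) \<otimes> e = w [^] (i + j + 1) \<otimes> frob e"
    using K_carrier [OF eK] by simp
  have "e = \<zero>"
    using w_pow_twisted_inj [OF eK _ tw] small by fastforce
  then have uv_eq: "u1 \<otimes> v2 = u2 \<otimes> v1"
    using car by (simp add: e_def)
  have fuv_eq: "frob u1 \<otimes> frob v2 = frob u2 \<otimes> frob v1"
    using car arg_cong [OF uv_eq, of frob] by (simp add: frob_mult)
  \<comment> \<open>By \<open>fuv_eq\<close> the terms with \<open>b\<close> on the two sides of
    \<open>coords(2)\<close> coincide and cancel.\<close>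
  have "u1 \<otimes> (a' \<otimes> frob v2) \<oplus> v2 \<otimes> (a \<otimes> frob u1) =
     (u1 \<otimes> (a' \<otimes> frob v2) \<oplus> v2 \<otimes> (a \<otimes> frob u1) \<ominus> b \<otimes> (a \<otimes> frob u1 \<otimes> (a' \<otimes> frob v2)))
     \<oplus> b \<otimes> a \<otimes> a' \<otimes> (frob u1 \<otimes> frob v2)"
    using car fcar by algebra
  also have "\<dots> = u2 \<otimes> (a' \<otimes> frob v1) \<oplus> v1 \<otimes> (a \<otimes> frob u2)"
    unfolding coords(2) fuv_eq using car fcar by algebra
  finally have lin: "u1 \<otimes> (a' \<otimes> frob v2) \<oplus> v2 \<otimes> (a \<otimes> frob u1) =
    u2 \<otimes> (a' \<otimes> frob v1) \<oplus> v1 \<otimes> (a \<otimes> frob u2)" .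
  obtain r where r: "r \<in> K" "r \<otimes> u1 = \<one>" "r \<noteq> \<zero>"
    using K_inv [OF uv(1) nz(1)] .
  have rcar: "r \<in> carrier L" using r K_carrier by blast
  \<comment> \<open>All parameters are expressed through \<open>u1\<close>: \<open>c\<close> and
    \<open>d\<close> are the ratios of \<open>v1\<close> and \<open>u2\<close> to it, and
    \<open>uv_eq\<close> then makes \<open>v2\<close> equal to
    \<open>c \<otimes> d \<otimes> u1\<close>.\<close>
  define c where "c = v1 \<otimes> r"
  define d where "d = u2 \<otimes> r"
  have cd: "c \<in> K" "d \<in> K" using uv r by (simp_all add: c_def d_def K')
  have cdcar: "c \<in> carrier L" "d \<in> carrier L" using cd K_carrier by auto
  have fcd: "frob c \<in> carrier L" "frob d \<in> carrier L" using cdcar by auto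
  have v1: "v1 = c \<otimes> u1" and u2: "u2 = d \<otimes> u1"
    using car rcar r(2) by (simp_all add: c_def d_def m_assoc)
  have "u1 \<otimes> v2 = u1 \<otimes> (c \<otimes> (d \<otimes> u1))"
    unfolding uv_eq unfolding u2 v1 using car cdcar by algebra
  then have v2: "v2 = c \<otimes> (d \<otimes> u1)"
    using car cdcar nz(1) by (simp add: m_lcancel)
  have c0: "c \<noteq> \<zero>"
    using v1 nz(2) car by auto
  have f: "frob v1 = frob c \<otimes> frob u1" "frob v2 = frob c \<otimes> (frob d \<otimes> frob u1)"
    "frob u2 = frob d \<otimes> frob u1"
    unfolding v1 v2 u2 using car cdcar by (simp_all add: frob_mult)
  have "u1 \<otimes> frob u1 \<otimes> ((frob d \<ominus> d) \<otimes> (a' \<otimes> frob c \<ominus> a \<otimes> c)) =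
    (u1 \<otimes> (a' \<otimes> frob v2) \<oplus> v2 \<otimes> (a \<otimes> frob u1)) \<ominus>
    (u2 \<otimes> (a' \<otimes> frob v1) \<oplus> v1 \<otimes> (a \<otimes> frob u2))"
    unfolding f unfolding v1 v2 u2 using car cdcar fcd fcar(1) by algebra
  also have "\<dots> = \<zero>"
    unfolding lin using car fcar by simp
  finally have "frob d \<ominus> d = \<zero> \<or> a' \<otimes> frob c \<ominus> a \<otimes> c = \<zero>"
    using car cdcar fcd fcar nz(1) frob_nonzero [OF car(1)] by (simp add: integral_iff)
  \<comment> \<open>The first case puts \<open>d\<close> into \<open>F\<close>. In the second,
    twisted injectivity gives \<open>i = j\<close>; cancelling the power of \<open>w\<close> leaves
    \<open>frob c = c\<close>.\<close>
  then consider "frob d = d" | "a \<otimes> c = a' \<otimes> frob c"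
    using car cdcar fcd by auto
  then show ?thesis
  proof cases
    case 1
    then show ?thesis using fixed_in_F [OF cd(2)] u2 by blast
  next
    case 2
    then have "i = j"
      using w_pow_twisted_inj [OF cd(1) c0, of i j] small by (simp add: a_def a'_def)
    moreover from this have "frob c = c"
      using 2 car cdcar fcd nat_pow_nonzero [OF car(8) w_nz, of j]
      by (simp add: a_def a'_def m_lcancel)
    ultimately show ?thesis using fixed_in_F [OF cd(1)] v1 by blast
  qed
qed

section \<open>Codewords and their intersections\<close>

definition word :: "'a \<Rightarrow> nat \<Rightarrow> 'a set"
  where "word \<alpha> i = (\<lambda>u. \<alpha> \<otimes> vec i u) ` K"

lemma word_eq: "\<alpha> <# frob_graph_space L K q s (w [^] i \<otimes> \<gamma>) = word \<alpha> i"
  unfolding frob_graph_space_eq by (auto simp: word_def l_coset_def)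

lemma zero_in_word: "\<alpha> \<in> carrier L \<Longrightarrow> \<zero> \<in> word \<alpha> i"
  using vec_zero [of i] K_sub(2) by (force simp: word_def image_iff)

lemma word_carrier: "\<alpha> \<in> carrier L \<Longrightarrow> word \<alpha> i \<subseteq> carrier L"
  using vec_closed by (auto simp: word_def)

lemma card_word:
  assumes "\<alpha> \<in> carrier L" "\<alpha> \<noteq> \<zero>"
  shows "card (word \<alpha> i) = q ^ t"
proof -
  have "inj_on (\<lambda>u. \<alpha> \<otimes> vec i u) K"
    using assms vec_closed vec_inj [of i] by (auto simp: inj_on_def m_lcancel)
  then show ?thesis by (simp add: word_def card_image K(2))
qed

text \<open>\<open>vec i\<close> is additive and, because \<open>frob\<close> fixes
  \<open>F\<close>, linear over \<open>F\<close>.\<close>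

lemma subalgebra_word:
  assumes \<alpha>: "\<alpha> \<in> carrier L"
  shows "subalgebra F (word \<alpha> i) L"
proof -
  have add: "x \<oplus> y \<in> word \<alpha> i" if xy: "x \<in> word \<alpha> i" "y \<in> word \<alpha> i" for x y
  proof -
    obtain u v where uv: "u \<in> K" "v \<in> K" "x = \<alpha> \<otimes> vec i u" "y = \<alpha> \<otimes> vec i v"
      using xy by (auto simp: word_def)
    then have "x \<oplus> y = \<alpha> \<otimes> vec i (u \<oplus> v)"
      using \<alpha> vec_closed by (simp add: vec_add r_distr)
    moreover have "u \<oplus> v \<in> K" using uv K_sub(7) by blast
    ultimately show ?thesis by (auto simp: word_def)
  qed
  have smult: "c \<otimes> x \<in> word \<alpha> i" if cx: "c \<in> F" "x \<in> word \<alpha> i" for c x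
  proof -
    obtain u where u: "u \<in> K" "x = \<alpha> \<otimes> vec i u" using cx by (auto simp: word_def)
    have "c \<otimes> x = \<alpha> \<otimes> vec i (c \<otimes> u)"
      using u \<alpha> cx F_carrier vec_closed by (simp add: vec_smult m_lcomm)
    moreover have "c \<otimes> u \<in> K" using u cx F_subset_K K_sub(6) by blast
    ultimately show ?thesis by (auto simp: word_def)
  qed
  have neg: "\<ominus> x \<in> word \<alpha> i" if "x \<in> word \<alpha> i" for x
  proof -
    have "x \<in> carrier L"
      using that word_carrier [OF \<alpha>] by blast
    then have "\<ominus> x = \<ominus> \<one> \<otimes> x"
      by (simp add: l_minus)
    then show ?thesis using smult [OF F_sub(5) [OF F_sub(3)] that] by simp
  qed
  have "subgroup (word \<alpha> i) (add_monoid L)"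
    using add.subgroupI [OF word_carrier [OF \<alpha>] _ neg add] zero_in_word [OF \<alpha>] by blast
  then show ?thesis
    using smult by (simp add: subalgebra_def subalgebra_axioms_def)
qed

lemma dimension_word: "\<alpha> \<in> carrier L \<Longrightarrow> \<alpha> \<noteq> \<zero> \<Longrightarrow> dimension t F (word \<alpha> i)"
  using dimension_of_card [OF F(1) fin subalgebra_word] card_word F(2) by simp

text \<open>One inclusion is closure under scalars from \<open>F\<close>; equal cardinalities do the
  rest.\<close>

lemma word_smult:
  assumes "\<beta> \<in> carrier L" "c \<in> F" "c \<noteq> \<zero>"
  shows "word (c \<otimes> \<beta>) i = word \<beta> i"
proof (rule card_seteq)
  have car: "c \<in> carrier L" using F_carrier assms by blast
  show "finite (word \<beta> i)"
    using word_carrier [OF assms(1)] fin finite_subset by blast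
  show "word (c \<otimes> \<beta>) i \<subseteq> word \<beta> i"
    using subalgebra.smult_closed [OF subalgebra_word [OF assms(1), of i] assms(2)] assms car vec_closed
    by (auto simp: word_def m_assoc)
  show "card (word \<beta> i) \<le> card (word (c \<otimes> \<beta>) i)"
  proof (cases "\<beta> = \<zero>")
    case True
    then show ?thesis using car by simp
  next
    case False
    then show ?thesis using car assms by (simp add: card_word integral_iff)
  qed
qed

text \<open>Take \<open>x\<close> from the first word and \<open>y\<close> from the second in the
  product \<open>x \<otimes> y\<close>, then the other way round. Cancelling
  \<open>\<alpha> \<otimes> \<beta>\<close> gives the hypothesis of
  \<open>cross_product\<close>.\<close>

lemma word_inter:
  assumes \<alpha>: "\<alpha> \<in> carrier L" and \<beta>: "\<beta> \<in> carrier L"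
    and ij: "i < \<tau>" "j < \<tau>"
    and x: "x \<in> word \<alpha> i \<inter> word \<beta> j" "x \<noteq> \<zero>" and y: "y \<in> word \<alpha> i \<inter> word \<beta> j"
  shows "(\<exists>d\<in>F. y = d \<otimes> x) \<or> (i = j \<and> (\<exists>c\<in>F. c \<noteq> \<zero> \<and> \<alpha> = c \<otimes> \<beta>))"
proof -
  obtain u1 v1 u2 v2 where uv: "u1 \<in> K" "v1 \<in> K" "u2 \<in> K" "v2 \<in> K"
    and x1: "x = \<alpha> \<otimes> vec i u1" and x2: "x = \<beta> \<otimes> vec j v1"
    and y1: "y = \<alpha> \<otimes> vec i u2" and y2: "y = \<beta> \<otimes> vec j v2"
    using x(1) y by (auto simp: word_def)
  have car: "vec i u1 \<in> carrier L" "vec j v1 \<in> carrier L" "vec i u2 \<in> carrier L" "vec j v2 \<in> carrier L"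
    using uv vec_closed by auto
  have nz: "u1 \<noteq> \<zero>" "v1 \<noteq> \<zero>" "\<alpha> \<noteq> \<zero>" "\<beta> \<noteq> \<zero>"
    using x(2) x1 x2 \<alpha> \<beta> car vec_zero by auto
  have "\<alpha> \<otimes> \<beta> \<otimes> (vec i u1 \<otimes> vec j v2) = x \<otimes> y"
    unfolding x1 unfolding y2 using \<alpha> \<beta> car by algebra
  also have "\<dots> = \<alpha> \<otimes> \<beta> \<otimes> (vec i u2 \<otimes> vec j v1)"
    unfolding x2 unfolding y1 using \<alpha> \<beta> car by algebra
  finally have "vec i u1 \<otimes> vec j v2 = vec i u2 \<otimes> vec j v1"
    using \<alpha> \<beta> nz car by (simp add: m_lcancel integral_iff)
  from cross_product [OF uv nz(1,2) ij this] consider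
    d where "d \<in> F" "u2 = d \<otimes> u1" | c where "i = j" "c \<in> F" "v1 = c \<otimes> u1" by blast
  then show ?thesis
  proof cases
    case 1
    then have "y = d \<otimes> x"
      using x1 y1 uv \<alpha> car F_carrier by (simp add: vec_smult m_lcomm)
    then show ?thesis using 1 by blast
  next
    case 2
    have c: "c \<noteq> \<zero>" using nz 2 K_carrier uv by auto
    have "\<alpha> \<otimes> vec i u1 = c \<otimes> \<beta> \<otimes> vec i u1"
      using x1 x2 2 uv \<beta> car F_carrier by (simp add: vec_smult m_assoc m_lcomm)
    moreover have "vec i u1 \<noteq> \<zero>" using vec_eq_zero_iff uv nz by simp
    ultimately have "\<alpha> = c \<otimes> \<beta>"
      using car \<alpha> \<beta> F_carrier [OF 2(2)] by (simp add: m_rcancel)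
    then show ?thesis using 2 c by blast
  qed
qed

text \<open>Once a nonzero common vector \<open>x\<close> is fixed, every common vector lies on the
  line \<open>F x\<close>, which has \<open>q\<close> points.\<close>

lemma card_word_inter:
  assumes \<alpha>: "\<alpha> \<in> carrier L" and \<beta>: "\<beta> \<in> carrier L" and ij: "i < \<tau>" "j < \<tau>"
    and indep: "\<not> (i = j \<and> (\<exists>c\<in>F. c \<noteq> \<zero> \<and> \<alpha> = c \<otimes> \<beta>))"
  shows "card (word \<alpha> i \<inter> word \<beta> j) \<le> q"
proof (cases "word \<alpha> i \<inter> word \<beta> j \<subseteq> {\<zero>}")
  case True
  then have "card (word \<alpha> i \<inter> word \<beta> j) \<le> card {\<zero>}"
    by (intro card_mono) auto
  then show ?thesis using q(2) by simp
next
  case False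
  then obtain x where x: "x \<in> word \<alpha> i \<inter> word \<beta> j" "x \<noteq> \<zero>" by blast
  have "word \<alpha> i \<inter> word \<beta> j \<subseteq> (\<lambda>d. d \<otimes> x) ` F"
    using word_inter [OF \<alpha> \<beta> ij x] indep by blast
  moreover have "finite F" using F_sub(1) fin finite_subset by blast
  ultimately show ?thesis
    using surj_card_le F(2) by blast
qed

text \<open>Equal words meet in \<open>q ^ t > q\<close> vectors, too many for
  \<open>card_word_inter\<close> unless the indices agree and the multipliers are proportional over
  \<open>F\<close>.\<close>

lemma word_eq_iff:
  assumes \<alpha>: "\<alpha> \<in> carrier L" "\<alpha> \<noteq> \<zero>" and \<beta>: "\<beta> \<in> carrier L" and ij: "i < \<tau>" "j < \<tau>"
  shows "word \<alpha> i = word \<beta> j \<longleftrightarrow> i = j \<and> (\<exists>c\<in>F - {\<zero>}. \<alpha> = c \<otimes> \<beta>)"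
proof
  assume eq: "word \<alpha> i = word \<beta> j"
  have "q ^ 1 < q ^ t"
    using t q(2) by (intro power_strict_increasing) auto
  then have "\<not> card (word \<alpha> i \<inter> word \<beta> j) \<le> q"
    using card_word [OF \<alpha>] eq [symmetric] by simp
  then show "i = j \<and> (\<exists>c\<in>F - {\<zero>}. \<alpha> = c \<otimes> \<beta>)"
    using card_word_inter [OF \<alpha>(1) \<beta> ij] by blast
next
  assume "i = j \<and> (\<exists>c\<in>F - {\<zero>}. \<alpha> = c \<otimes> \<beta>)"
  then show "word \<alpha> i = word \<beta> j"
    using word_smult [OF \<beta>] by blast
qed

section \<open>The code and its size\<close>

text \<open>Written as an image of index pairs, so that the size can be found by counting
  fibres.\<close>

definition code :: "'a set set"
  where "code = (\<lambda>(i, \<alpha>). word \<alpha> i) ` ({..<\<tau>} \<times> (carrier L - {\<zero>}))"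

lemma orbit_union_code_eq: "orbit_union_code L K q s w \<gamma> \<tau> = code"
  unfolding orbit_union_code_def cyclic_orbit_def word_eq code_def by auto

lemma codeE:
  assumes "U \<in> code"
  obtains i \<alpha> where "U = word \<alpha> i" "i < \<tau>" "\<alpha> \<in> carrier L" "\<alpha> \<noteq> \<zero>"
  using assms by (auto simp: code_def)

lemma codeI: "i < \<tau> \<Longrightarrow> \<alpha> \<in> carrier L \<Longrightarrow> \<alpha> \<noteq> \<zero> \<Longrightarrow> word \<alpha> i \<in> code"
  by (auto simp: code_def)

lemma finite_code: "finite code"
  using fin by (simp add: code_def)

lemma code_grassmannian: "code \<subseteq> grassmannian L F t"
  using subalgebra_word dimension_word by (auto simp: grassmannian_def elim!: codeE)

text \<open>Each codeword comes from exactly \<open>q - 1\<close> pairs: the index is determined,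
  and the multiplier is determined up to a factor in \<open>F - {\<zero>}\<close>.\<close>

lemma card_code: "\<tau> * (q ^ (2 * t) - 1) = card code * (q - 1)"
proof -
  define P where "P = {..<\<tau>} \<times> (carrier L - {\<zero>})"
  define f where "f = (\<lambda>(i, \<alpha>). word \<alpha> i)"
  have finP: "finite P" using fin by (simp add: P_def)
  have fibre: "card {p \<in> P. f p = U} = q - 1" if "U \<in> code" for U
  proof -
    obtain j \<beta> where U: "U = word \<beta> j" "j < \<tau>" "\<beta> \<in> carrier L" "\<beta> \<noteq> \<zero>"
      using \<open>U \<in> code\<close> by (rule codeE)
    have "{p \<in> P. f p = U} = (\<lambda>c. (j, c \<otimes> \<beta>)) ` (F - {\<zero>})"
    proof (intro subset_antisym subsetI)
      fix p assume "p \<in> {p \<in> P. f p = U}"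
      then obtain i \<alpha> where p: "p = (i, \<alpha>)" "i < \<tau>" "\<alpha> \<in> carrier L" "\<alpha> \<noteq> \<zero>" "word \<alpha> i = word \<beta> j"
        by (auto simp: P_def f_def U)
      then show "p \<in> (\<lambda>c. (j, c \<otimes> \<beta>)) ` (F - {\<zero>})"
        using word_eq_iff [of \<alpha> \<beta> i j] U by blast
    next
      fix p assume "p \<in> (\<lambda>c. (j, c \<otimes> \<beta>)) ` (F - {\<zero>})"
      then obtain c where c: "c \<in> F" "c \<noteq> \<zero>" "p = (j, c \<otimes> \<beta>)" by blast
      then show "p \<in> {p \<in> P. f p = U}"
        using U word_smult [OF U(3), of c j] F_carrier by (simp add: P_def f_def integral_iff)
    qed
    moreover have "inj_on (\<lambda>c. (j, c \<otimes> \<beta>)) (F - {\<zero>})"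
      using U F_carrier by (auto simp: inj_on_def m_rcancel)
    ultimately show ?thesis
      using F(2) F_sub(2) by (simp add: card_image)
  qed
  have "card P = (\<Sum>U\<in>f ` P. card {p \<in> P. f p = U})"
    using sum.image_gen [OF finP, of "\<lambda>_. 1::nat" f] by simp
  also have "\<dots> = card code * (q - 1)"
    using fibre by (simp add: code_def P_def f_def)
  finally show ?thesis
    by (simp add: P_def card_cartesian_product card_L)
qed

section \<open>The minimum distance\<close>

lemma dim_word: "\<alpha> \<in> carrier L \<Longrightarrow> \<alpha> \<noteq> \<zero> \<Longrightarrow> dim F (word \<alpha> i) = t"
  using dimI [OF F(1) dimension_word] by (simp add: over_def)

lemma card_word_inter_dim:
  assumes "\<alpha> \<in> carrier L" "\<beta> \<in> carrier L"
  shows "card (word \<alpha> i \<inter> word \<beta> j) = q ^ dim F (word \<alpha> i \<inter> word \<beta> j)"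
proof -
  obtain m where m: "dimension m F (word \<alpha> i \<inter> word \<beta> j)"
    using finite_dimension_subalgebra [OF F(1) fin subalgebra_inter] assms subalgebra_word by blast
  then show ?thesis
    using dimI [OF F(1) m] card_dimension [OF F(1) m] F(2) by (simp add: over_def)
qed

lemma dist_word:
  "\<alpha> \<in> carrier L \<Longrightarrow> \<alpha> \<noteq> \<zero> \<Longrightarrow> \<beta> \<in> carrier L \<Longrightarrow> \<beta> \<noteq> \<zero> \<Longrightarrow>
    subspace_dist L F (word \<alpha> i) (word \<beta> j) = 2 * int t - 2 * int (dim F (word \<alpha> i \<inter> word \<beta> j))"
  by (simp add: subspace_dist_def dim_word)

lemma dim_word_inter_le:
  assumes \<alpha>: "\<alpha> \<in> carrier L" and \<beta>: "\<beta> \<in> carrier L" and ij: "i < \<tau>" "j < \<tau>"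
    and neq: "word \<alpha> i \<noteq> word \<beta> j"
  shows "dim F (word \<alpha> i \<inter> word \<beta> j) \<le> 1"
proof -
  have "card (word \<alpha> i \<inter> word \<beta> j) \<le> q"
    using card_word_inter [OF \<alpha> \<beta> ij] neq word_smult [OF \<beta>] by blast
  then have "q ^ dim F (word \<alpha> i \<inter> word \<beta> j) \<le> q ^ 1"
    using card_word_inter_dim [OF \<alpha> \<beta>] by simp
  then show ?thesis
    using q(2) power_le_imp_le_exp by (meson less_le_trans one_less_numeral_iff semiring_norm(77))
qed

text \<open>The quotient \<alpha> of \<open>vec 0 u\<close> by \<open>vec 0 \<one>\<close>, with
  \<open>u\<close> in \<open>K\<close> outside \<open>F\<close>, makes \<open>vec 0 u\<close> a
  common vector. If the words were equal, \<alpha> would lie in \<open>F\<close>, and linearity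
  would give \<open>u = \<alpha>\<close>.\<close>

lemma exists_intersecting_words:
  obtains \<alpha> where "\<alpha> \<in> carrier L" "\<alpha> \<noteq> \<zero>" "word \<alpha> 0 \<noteq> word \<one> 0" "dim F (word \<alpha> 0 \<inter> word \<one> 0) \<ge> 1"
proof -
  have finF: "finite F" using F_sub(1) fin finite_subset by blast
  \<comment> \<open>Here \<open>t \<ge> 2\<close> enters: \<open>K\<close> is strictly larger than
    \<open>F\<close>, so a suitable \<open>u\<close> exists.\<close>
  have "q ^ 1 < q ^ t"
    using t q(2) by (intro power_strict_increasing) auto
  then have "\<not> K \<subseteq> F"
    using card_mono [OF finF, of K] F(2) K(2) by auto
  then obtain u where u: "u \<in> K" "u \<notin> F" by blast
  then have u0: "u \<noteq> \<zero>" using F_sub(2) by blast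
  define y where "y = vec 0 \<one>"
  define x where "x = vec 0 u"
  have y: "y \<in> carrier L" "y \<noteq> \<zero>"
    using vec_closed vec_eq_zero_iff K_sub(3) by (auto simp: y_def)
  have x: "x \<in> carrier L" "x \<noteq> \<zero>"
    using vec_closed vec_eq_zero_iff u u0 by (auto simp: x_def)
  obtain z where z: "z \<in> carrier L" "z \<otimes> y = \<one>"
    using y field_Units Units_l_inv_ex by blast
  define \<alpha> where "\<alpha> = x \<otimes> z"
  have \<alpha>: "\<alpha> \<in> carrier L" using x z by (simp add: \<alpha>_def)
  have \<alpha>y: "\<alpha> \<otimes> y = x" using x y z by (simp add: \<alpha>_def m_assoc)
  then have \<alpha>0: "\<alpha> \<noteq> \<zero>" using x y by auto
  have \<tau>0: "0 < \<tau>" using \<tau> q(2) by auto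
  have "word \<alpha> 0 \<noteq> word \<one> 0"
  proof
    assume "word \<alpha> 0 = word \<one> 0"
    then obtain c where c: "c \<in> F" "\<alpha> = c \<otimes> \<one>"
      using word_eq_iff [OF \<alpha> \<alpha>0 one_closed \<tau>0 \<tau>0] by blast
    then have "vec 0 u = vec 0 (c \<otimes> \<one>)"
      unfolding vec_smult [OF c(1) K_sub(3)] using \<alpha>y c F_carrier by (simp add: x_def y_def)
    then have "u = c"
      using inj_onD [OF vec_inj] u c F_carrier F_subset_K by simp
    then show False using u c by blast
  qed
  moreover have "dim F (word \<alpha> 0 \<inter> word \<one> 0) \<ge> 1"
  \<comment> \<open>In dimension \<open>0\<close> the intersection would have
    \<open>q ^ 0 = 1\<close> element, yet it contains both \<open>x\<close> and
    \<open>\<zero>\<close>.\<close>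
  proof (rule ccontr)
    assume "\<not> dim F (word \<alpha> 0 \<inter> word \<one> 0) \<ge> 1"
    then have "card (word \<alpha> 0 \<inter> word \<one> 0) = 1"
      using card_word_inter_dim [OF \<alpha> one_closed, of 0 0] by simp
    moreover have "x \<in> word \<alpha> 0 \<inter> word \<one> 0"
      using \<alpha>y x u K_sub(3) by (force simp: word_def x_def y_def)
    moreover have "\<zero> \<in> word \<alpha> 0 \<inter> word \<one> 0"
      using zero_in_word \<alpha> by simp
    ultimately show False using x(2) by (metis card_1_singletonE singletonD)
  qed
  ultimately show ?thesis using that \<alpha> \<alpha>0 by blast
qed

lemma min_distance_code: "min_distance L F code = 2 * int t - 2"
  unfolding min_distance_def
proof (rule Min_eqI)
  have "{subspace_dist L F U V |U V. U \<in> code \<and> V \<in> code \<and> U \<noteq> V}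
      \<subseteq> (\<lambda>(U, V). subspace_dist L F U V) ` (code \<times> code)" by auto
  then show "finite {subspace_dist L F U V |U V. U \<in> code \<and> V \<in> code \<and> U \<noteq> V}"
    using finite_code finite_subset by blast
next
  fix d assume "d \<in> {subspace_dist L F U V |U V. U \<in> code \<and> V \<in> code \<and> U \<noteq> V}"
  then obtain U V where UV: "d = subspace_dist L F U V" "U \<in> code" "V \<in> code" "U \<noteq> V" by blast
  obtain i \<alpha> where U: "U = word \<alpha> i" "i < \<tau>" "\<alpha> \<in> carrier L" "\<alpha> \<noteq> \<zero>"
    using UV(2) by (rule codeE)
  obtain j \<beta> where V: "V = word \<beta> j" "j < \<tau>" "\<beta> \<in> carrier L" "\<beta> \<noteq> \<zero>"
    using UV(3) by (rule codeE)
  show "2 * int t - 2 \<le> d"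
    using dim_word_inter_le [OF U(3) V(3) U(2) V(2)] UV(1,4) U V by (simp add: dist_word)
next
  obtain \<alpha> where \<alpha>: "\<alpha> \<in> carrier L" "\<alpha> \<noteq> \<zero>" "word \<alpha> 0 \<noteq> word \<one> 0"
    "dim F (word \<alpha> 0 \<inter> word \<one> 0) \<ge> 1"
    by (rule exists_intersecting_words)
  \<comment> \<open>\<open>q \<ge> 3\<close> guarantees the orbit with index \<open>0\<close>, which
    contains both witnesses.\<close>
  have \<tau>0: "0 < \<tau>" using \<tau> q(2) by auto
  have "dim F (word \<alpha> 0 \<inter> word \<one> 0) = 1"
    using dim_word_inter_le [OF \<alpha>(1) one_closed \<tau>0 \<tau>0] \<alpha> by simp
  then have "2 * int t - 2 = subspace_dist L F (word \<alpha> 0) (word \<one> 0)"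
    using \<alpha> by (simp add: dist_word)
  then show "2 * int t - 2 \<in> {subspace_dist L F U V |U V. U \<in> code \<and> V \<in> code \<and> U \<noteq> V}"
    using \<alpha> codeI [OF \<tau>0] one_closed one_not_zero by blast
qed

end

theorem theorem8p5:
  fixes L (structure) and F K :: "'a set" and q t n s \<tau> :: nat and w b \<gamma>0 :: 'a
  assumes "primepow q" and "q \<ge> 3"
    and "t \<ge> 2" and "n = 2 * t"
    and "field L" and "finite (carrier L)" and "card (carrier L) = q ^ n"
    and "subfield F L" and "card F = q"
    and "subfield K L" and "card K = q ^ t"
    and "primitive_element L K w"
    and "s > 0" and "gcd s t = 1"
    and "\<not> (\<exists>y\<in>K. w = y [^] (q ^ s - 1))"
    and "b \<in> K" and "pirreducible K [\<one>, b, w]"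
    and "\<gamma>0 \<in> carrier L" and "ring.eval L [\<one>, b, w] \<gamma>0 = \<zero>"
    and "\<tau> = (q - 1) div 2"
  defines "G \<equiv> orbit_union_code L K q s w \<gamma>0 \<tau>"
  shows "G \<subseteq> grassmannian L F t
    \<and> real (card G) = real \<tau> * ((real q ^ n - 1) / (real q - 1))
    \<and> min_distance L F G = 2 * int t - 2"
proof -
  interpret frobenius_graph_code L F K q t s \<tau> w b \<gamma>0
    using assms by (simp add: frobenius_graph_code_def frobenius_graph_code_axioms_def)
  have "real (\<tau> * (q ^ n - 1)) = real (card G * (q - 1))"
    using card_code assms(4) by (simp add: G_def orbit_union_code_eq)
  \<comment> \<open>Passing to the reals is safe because neither subtraction is truncated.\<close>
  then have "real \<tau> * (real q ^ n - 1) = real (card G) * (real q - 1)"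
    using assms(2) by (simp add: of_nat_diff)
  moreover have "real q - 1 \<noteq> 0" using assms(2) by simp
  ultimately have "real (card G) = real \<tau> * ((real q ^ n - 1) / (real q - 1))"
    by (simp add: field_simps)
  then show ?thesis
    using code_grassmannian min_distance_code by (simp add: G_def orbit_union_code_eq)
qed

end
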